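(* Let $C$ be a proper cone with non-empty interior in a Banach space $(X,\|\cdot\|)$, and let $(f_a)_{a\in\mathcal A}$ be a family of homogeneous maps $X\to X$. Assume that $(f_a)_{a\in\mathcal A}$ admits a lower selection and denote by $f=\inf_{a\in\mathcal A}f_a$ its infimum. Then $f$ is homogeneous and $$\operatorname{cw}_C(f)=\inf_{a\in\mathcal A}\operatorname{cw}_C(f_a).$$ Assume in addition that the maps $f_a$ are continuous and order-preserving with respect to $C$, that $f$ is continuous and that $C$ is a normal cone. Then $f$ is order-preserving, and $$r_C(f)\le\inf_{a\in\mathcal A}r_C(f_a).$$ When, in addition, either $\nu_C(f)<\operatorname{cw}_C(f)$ or $f$ is uniformly continuous on bounded sets of $C$, the following equalities hold: $$r_C(f)=\inf_{a\in\mathcal A}r_C(f_a)=\inf_{a\in\mathcal A}\operatorname{cw}_C(f_a)=\operatorname{cw}_C(f).$$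
   Context: A subset $C$ of the real Banach space $X$ is a cone if $tC\subset C$ for all $t\ge 0$; it is proper if it is closed, convex and pointed ($C\cap(-C)=\{0\}$). A proper cone induces the partial order $x\le y\iff y-x\in C$. $C$ is normal if it is proper and there is a constant $M$ with $\|x\|\le M\|y\|$ whenever $0\le x\le y$. Homogeneous: $g(tx)=tg(x)$ for all $t>0$. Order-preserving: $x\le y$ implies $g(x)\le g(y)$. The family $(f_a)_{a\in\mathcal A}$ admits a lower selection if for all $x\in X$ there is $a_x\in\mathcal A$ such that $f_{a_x}(x)\le f_b(x)$ for all $b\in\mathcal A$; its infimum is the map $f:X\to X$, $f(x)=f_{a_x}(x)$. For a homogeneous $g:X\to X$, the Collatz-Wielandt number is $\operatorname{cw}_C(g)=\inf\{\lambda>0\mid\exists x\in\operatorname{int}C,\ g(x)\le\lambda x\}$; when $g(C)\subset C$ (automatic for continuous homogeneous order-preserving $g$), $r_C(g)=\sup_{x\in C}\limsup_{k\to\infty}\|g^k(x)\|^{1/k}$. Fix a homogeneous generalized measure of noncompactness $\nu$ on $X$, that is, a map $\nu$ from the bounded subsets of $X$ to $[0,\infty)$ such that, for all bounded $A,B\subset X$ and scalars $\lambda$: $\nu(A)=0$ iff $\operatorname{cl}A$ is compact; $\nu(A+B)\le\nu(A)+\nu(B)$; $\nu(\operatorname{cl}\operatorname{conv}A)=\nu(A)$; $\nu(\lambda A)=|\lambda|\nu(A)$; $A\subset B$ implies $\nu(A)\le\nu(B)$. Set $\nu_C(g)=\inf\{\lambda>0\mid \nu(g(A))\le\lambda\nu(A)\text{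 for all bounded }A\subset C\}$. *)

theory Defs
  imports "HOL-Analysis.Analysis"
begin

definition proper_cone :: "'a::real_normed_vector set \<Rightarrow> bool" where
  "proper_cone C \<longleftrightarrow> cone C \<and> closed C \<and> convex C \<and> C \<inter> uminus ` C = {0}"

definition cone_le :: "'a::real_normed_vector set \<Rightarrow> 'a \<Rightarrow> 'a \<Rightarrow> bool" where
  "cone_le C x y \<longleftrightarrow> y - x \<in> C"

definition normal_cone :: "'a::real_normed_vector set \<Rightarrow> bool" where
  "normal_cone C \<longleftrightarrow> proper_cone C \<and>
     (\<exists>M::real. \<forall>x y. cone_le C 0 x \<and> cone_le C x y \<longrightarrow> norm x \<le> M * norm y)"

definition homogeneous_map :: "('a::real_normed_vector \<Rightarrow> 'a) \<Rightarrow> bool" where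
  "homogeneous_map g \<longleftrightarrow> (\<forall>t>0. \<forall>x. g (t *\<^sub>R x) = t *\<^sub>R g x)"

definition order_preserving :: "'a::real_normed_vector set \<Rightarrow> ('a \<Rightarrow> 'a) \<Rightarrow> bool" where
  "order_preserving C g \<longleftrightarrow> (\<forall>x y. cone_le C x y \<longrightarrow> cone_le C (g x) (g y))"

definition admits_lower_selection ::
    "'a::real_normed_vector set \<Rightarrow> 'i set \<Rightarrow> ('i \<Rightarrow> 'a \<Rightarrow> 'a) \<Rightarrow> bool" where
  "admits_lower_selection C \<A> F \<longleftrightarrow>
     (\<forall>x. \<exists>a\<in>\<A>. \<forall>b\<in>\<A>. cone_le C (F a x) (F b x))"

text \<open>The value does not depend on the chosen minimizing index, because the order
  induced by a proper cone is antisymmetric.\<close>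

definition infimum_map ::
    "'a::real_normed_vector set \<Rightarrow> 'i set \<Rightarrow> ('i \<Rightarrow> 'a \<Rightarrow> 'a) \<Rightarrow> 'a \<Rightarrow> 'a" where
  "infimum_map C \<A> F x =
     F (SOME a. a \<in> \<A> \<and> (\<forall>b\<in>\<A>. cone_le C (F a x) (F b x))) x"

text \<open>The three numbers below live in the extended reals, so that an infimum over the empty
  set is \<open>\<infinity>\<close> and suprema and upper limits always exist.\<close>

definition cw :: "'a::real_normed_vector set \<Rightarrow> ('a \<Rightarrow> 'a) \<Rightarrow> ereal" where
  "cw C g = Inf {ereal l | l. l > 0 \<and> (\<exists>x\<in>interior C. cone_le C (g x) (l *\<^sub>R x))}"

text \<open>Meaningful for maps \<open>g\<close> with \<open>g ` C \<subseteq> C\<close>.\<close>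

definition cone_spectral_radius ::
    "'a::real_normed_vector set \<Rightarrow> ('a \<Rightarrow> 'a) \<Rightarrow> ereal" where
  "cone_spectral_radius C g =
     (SUP x\<in>C. limsup (\<lambda>k. ereal (root k (norm ((g ^^ k) x)))))"

text \<open>The values of \<open>\<nu>\<close> on unbounded sets are irrelevant.\<close>

definition homogeneous_mnc :: "('a::real_normed_vector set \<Rightarrow> real) \<Rightarrow> bool" where
  "homogeneous_mnc \<nu> \<longleftrightarrow>
     (\<forall>A. bounded A \<longrightarrow> 0 \<le> \<nu> A) \<and>
     (\<forall>A. bounded A \<longrightarrow> (\<nu> A = 0 \<longleftrightarrow> compact (closure A))) \<and>
     (\<forall>A B. bounded A \<and> bounded B \<longrightarrow> \<nu> {x + y | x y. x \<in> A \<and> y \<in> B} \<le> \<nu> A + \<nu> B) \<and>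
     (\<forall>A. bounded A \<longrightarrow> \<nu> (closure (convex hull A)) = \<nu> A) \<and>
     (\<forall>A c. bounded A \<longrightarrow> \<nu> ((*\<^sub>R) c ` A) = \<bar>c\<bar> * \<nu> A) \<and>
     (\<forall>A B. bounded A \<and> bounded B \<and> A \<subseteq> B \<longrightarrow> \<nu> A \<le> \<nu> B)"

text \<open>Meaningful for maps \<open>g\<close> sending bounded subsets of \<open>C\<close> to bounded sets, as every
  continuous homogeneous map does.\<close>

definition mnc_coeff ::
    "('a::real_normed_vector set \<Rightarrow> real) \<Rightarrow> 'a set \<Rightarrow> ('a \<Rightarrow> 'a) \<Rightarrow> ereal" where
  "mnc_coeff \<nu> C g =
     Inf {ereal l | l. l > 0 \<and> (\<forall>A. bounded A \<and> A \<subseteq> C \<longrightarrow> \<nu> (g ` A) \<le> l * \<nu> A)}"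

end

theory Submission
  imports Defs
begin

text \<open>
  The substance is \<open>cw C f \<le> r(f)\<close>. Let \<open>c = cw C f > 0\<close>,
  \<open>\<lambda> > c\<close>, let \<open>u\<close> be an interior point of \<open>C\<close> and \<open>g x = f x / \<lambda> + u\<close>. Some multiple of a
  subeigenvector bounds the orbit of \<open>u\<close> under \<open>g\<close>, and adding \<open>u\<close> makes \<open>g\<close> contract
  the ratio of successive iterates, so some iterate \<open>x\<close> satisfies \<open>x \<le> g x \<le> t x\<close> with \<open>t\<close> close
  to 1. Then \<open>f x \<le> \<lambda> (t - 1 / \<parallel>x\<parallel>) x\<close>, so the definition of \<open>c\<close> forces \<open>\<parallel>x\<parallel>\<close> to be large when
  \<open>\<lambda>\<close> is close to \<open>c\<close> and \<open>t\<close> to 1, and \<open>x / \<parallel>x\<parallel>\<close> is an approximate eigenvector for \<open>c\<close>. Under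
  the condition on \<open>\<nu>\<close> approximate eigenvectors accumulate at an eigenvector; under
  uniform continuity their orbits follow \<open>c\<^sup>k\<close> for any prescribed number of steps.
\<close>

section \<open>The order induced by a proper cone\<close>

lemma proper_cone_zero: "proper_cone C \<Longrightarrow> 0 \<in> C"
  unfolding proper_cone_def by blast

lemma proper_cone_add: "proper_cone C \<Longrightarrow> x \<in> C \<Longrightarrow> y \<in> C \<Longrightarrow> x + y \<in> C"
  using convex_cone[of C] unfolding proper_cone_def by blast

lemma proper_cone_scaleR: "proper_cone C \<Longrightarrow> 0 \<le> s \<Longrightarrow> x \<in> C \<Longrightarrow> s *\<^sub>R x \<in> C"
  unfolding proper_cone_def cone_def by blast

lemma cone_le_refl: "proper_cone C \<Longrightarrow> cone_le C x x"
  by (simp add: cone_le_def proper_cone_zero)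

lemma cone_le_trans:
  assumes "proper_cone C" "cone_le C x y" "cone_le C y z"
  shows "cone_le C x z"
  using proper_cone_add[OF assms(1), of "y - x" "z - y"] assms(2,3)
  by (simp add: cone_le_def)

lemma cone_le_antisym:
  assumes "proper_cone C" "cone_le C x y" "cone_le C y x"
  shows "x = y"
proof -
  have "x - y \<in> C \<inter> uminus ` C"
    using assms(2,3) unfolding cone_le_def by (auto intro!: image_eqI[of _ _ "y - x"])
  then have "x - y = 0"
    using assms(1) unfolding proper_cone_def by blast
  then show ?thesis
    by simp
qed

lemma cone_le_add:
  assumes "proper_cone C" "cone_le C x y" "cone_le C z w"
  shows "cone_le C (x + z) (y + w)"
  using proper_cone_add[OF assms(1), of "y - x" "w - z"] assms(2,3)
  by (simp add: cone_le_def algebra_simps)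

lemma cone_le_scaleR:
  assumes "proper_cone C" "cone_le C x y" "0 \<le> s"
  shows "cone_le C (s *\<^sub>R x) (s *\<^sub>R y)"
  using proper_cone_scaleR[OF assms(1,3), of "y - x"] assms(2)
  by (simp add: cone_le_def scaleR_diff_right)

lemma cone_le_scaleR_left:
  assumes "proper_cone C" "cone_le C 0 x" "s \<le> t"
  shows "cone_le C (s *\<^sub>R x) (t *\<^sub>R x)"
  using proper_cone_scaleR[OF assms(1), of "t - s" x] assms(2,3)
  by (simp add: cone_le_def scaleR_diff_left)

section \<open>Order units and interior points\<close>

text \<open>For a proper cone this normalised form says that \<open>u\<close> dominates the whole
  closed unit ball; it keeps the later constants explicit.\<close>

definition order_unit :: "'a::real_normed_vector set \<Rightarrow> 'a \<Rightarrow> bool" where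
  "order_unit C u \<longleftrightarrow> (\<forall>x. cone_le C x (norm x *\<^sub>R u))"

text \<open>Testing the unit property at \<open>- u\<close> puts a positive multiple of
  \<open>u\<close> into the cone.\<close>

lemma order_unit_nonneg:
  assumes "proper_cone C" "order_unit C u"
  shows "cone_le C 0 u"
proof -
  have neg: "cone_le C (- u) (norm (- u) *\<^sub>R u)"
    using assms(2) unfolding order_unit_def by blast
  define n where "n = norm u + 1"
  have n: "n > 0"
    unfolding n_def by (simp add: add_nonneg_pos)
  have "n *\<^sub>R u \<in> C"
    using neg by (simp add: n_def cone_le_def scaleR_add_left)
  then show ?thesis
    using proper_cone_scaleR[OF assms(1), of "1 / n" "n *\<^sub>R u"] n by (simp add: cone_le_def)
qed

lemma order_unit_mono:
  assumes "proper_cone C" "order_unit C u" "cone_le C u v"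
  shows "order_unit C v"
  using assms cone_le_scaleR[OF assms(1,3) norm_ge_zero] cone_le_trans[OF assms(1)]
  unfolding order_unit_def by blast

text \<open>If \<open>norm (u - z) < 1\<close>, then \<open>u - z\<close> lies below
  \<open>u\<close>, so \<open>z\<close> is in \<open>C\<close>: the cone contains the open unit ball
  about \<open>u\<close>.\<close>

lemma order_unit_interior:
  assumes C: "proper_cone C" and u: "order_unit C u"
  shows "u \<in> interior C"
proof -
  have "ball u 1 \<subseteq> C"
  proof
    fix z assume "z \<in> ball u 1"
    then have "norm (u - z) \<le> 1"
      by (simp add: dist_norm)
    then have "cone_le C (norm (u - z) *\<^sub>R u) (1 *\<^sub>R u)"
      by (intro cone_le_scaleR_left order_unit_nonneg C u)
    moreover have "cone_le C (u - z) (norm (u - z) *\<^sub>R u)"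
      using u by (simp add: order_unit_def)
    ultimately have "cone_le C (u - z) u"
      using cone_le_trans[OF C] by fastforce
    then show "z \<in> C"
      by (simp add: cone_le_def)
  qed
  then show ?thesis
    by (intro interiorI[of "ball u 1"]) auto
qed

text \<open>If the closed ball of radius \<open>e\<close> about \<open>v\<close> lies in
  \<open>C\<close>, then \<open>v\<close> minus any vector of norm \<open>e\<close> is in
  \<open>C\<close>; rescaling shows that \<open>v / e\<close> is an order unit.\<close>

lemma interior_order_unit:
  assumes C: "proper_cone C" and "v \<in> interior C"
  obtains s where "0 < s" "order_unit C (s *\<^sub>R v)"
proof -
  obtain e where e: "e > 0" "cball v e \<subseteq> C"
    using assms(2) mem_interior_cball by blast
  have "cone_le C x (norm x *\<^sub>R (1 / e) *\<^sub>R v)" for x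
  proof (cases "x = 0")
    case True
    then show ?thesis by (simp add: cone_le_refl C)
  next
    case False
    have "v - (e / norm x) *\<^sub>R x \<in> C"
      using e False by (intro subsetD[OF e(2)]) (simp add: dist_norm)
    then have "(norm x / e) *\<^sub>R (v - (e / norm x) *\<^sub>R x) \<in> C"
      using e by (intro proper_cone_scaleR C) auto
    then show ?thesis
      using e False by (simp add: cone_le_def scaleR_diff_right)
  qed
  then show ?thesis
    using e(1) by (intro that[of "1 / e"]) (auto simp: order_unit_def)
qed

section \<open>Homogeneous order-preserving maps and the normality constant\<close>

lemma homogeneous_map_zero:
  assumes "homogeneous_map g"
  shows "g 0 = 0"
proof -
  have "g ((2::real) *\<^sub>R 0) = 2 *\<^sub>R g 0"
    using assms zero_less_numeral unfolding homogeneous_map_def by blast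
  then show ?thesis by (simp add: scaleR_2)
qed

lemma order_preserving_funpow:
  assumes "order_preserving C g" "cone_le C x y"
  shows "cone_le C ((g ^^ k) x) ((g ^^ k) y)"
  using assms by (induction k) (auto simp: order_preserving_def)

lemma funpow_nonneg:
  assumes "homogeneous_map g" "order_preserving C g" "cone_le C 0 x"
  shows "cone_le C 0 ((g ^^ k) x)"
proof -
  have "(g ^^ k) 0 = 0"
    using homogeneous_map_zero[OF assms(1)] by (induction k) auto
  then show ?thesis
    using order_preserving_funpow[OF assms(2,3), of k] by simp
qed

text \<open>The constant is enlarged to at least 1; its positivity matters when k-th roots are
  taken.\<close>

lemma normal_coneE:
  assumes "normal_cone C"
  obtains M where "M > 0" "\<And>x y. cone_le C 0 x \<Longrightarrow> cone_le C x y \<Longrightarrow> norm x \<le> M * norm y"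
proof -
  obtain M where M: "\<And>x y. cone_le C 0 x \<Longrightarrow> cone_le C x y \<Longrightarrow> norm x \<le> M * norm y"
    using assms unfolding normal_cone_def by blast
  have "M * norm y \<le> max M 1 * norm y" for y :: 'a
    by (intro mult_right_mono) auto
  with M show ?thesis
    by (intro that[of "max M 1"]) (auto intro: order_trans)
qed

section \<open>Bounds for the cone spectral radius\<close>

text \<open>The k-th roots of a positive constant tend to 1, so constant factors disappear in the
  upper limit.\<close>

lemma limsup_root_le:
  assumes "M > 0" "\<And>k. a k \<le> M * b k"
  shows "limsup (\<lambda>k. ereal (root k (a k))) \<le> limsup (\<lambda>k. ereal (root k (b k)))"
proof -
  have "limsup (\<lambda>k. ereal (root k (a k))) \<le> limsup (\<lambda>k. ereal (root k M) * ereal (root k (b k)))"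
  proof (intro Limsup_mono always_eventually allI)
    fix k
    show "ereal (root k (a k)) \<le> ereal (root k M) * ereal (root k (b k))"
      using assms(2)[of k] by (cases "k = 0") (auto simp: real_root_mult[symmetric])
  qed
  also have "\<dots> = 1 * limsup (\<lambda>k. ereal (root k (b k)))"
  proof (rule ereal_limsup_lim_mult)
    show "(\<lambda>k. ereal (root k M)) \<longlonglongrightarrow> 1"
      using LIMSEQ_root_const[OF assms(1)] by (simp add: one_ereal_def)
  qed auto
  finally show ?thesis by simp
qed

text \<open>The sequence is constant from index 1 on; at index 0 it is 0, because
  \<open>root 0\<close> vanishes.\<close>

lemma limsup_root_power:
  assumes "(b::real) \<ge> 0"
  shows "limsup (\<lambda>k. ereal (root k (b ^ k))) = ereal b"
proof (rule lim_imp_Limsup)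
  have "\<forall>\<^sub>F k in sequentially. ereal b = ereal (root k (b ^ k))"
    using eventually_gt_at_top[of 0] by eventually_elim (use assms in \<open>simp add: real_root_power_cancel\<close>)
  then show "(\<lambda>k. ereal (root k (b ^ k))) \<longlonglongrightarrow> ereal b"
    by (rule tendsto_eventually[OF eventually_mono]) auto
qed auto

lemma cone_spectral_radius_ge:
  assumes "x \<in> C" "M > 0" "c \<ge> 0" "\<And>k. c ^ k \<le> M * norm ((g ^^ k) x)"
  shows "ereal c \<le> cone_spectral_radius C g"
proof -
  have "ereal c \<le> limsup (\<lambda>k. ereal (root k (norm ((g ^^ k) x))))"
    using limsup_root_le[where a = "\<lambda>k. c ^ k", OF assms(2,4)] limsup_root_power[OF assms(3)] by simp
  also have "\<dots> \<le> cone_spectral_radius C g"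
    unfolding cone_spectral_radius_def using assms(1) by (rule SUP_upper)
  finally show ?thesis .
qed

text \<open>Since 0 lies in \<open>C\<close>, the supremum is not over the empty set, where it would
  be minus infinity.\<close>

lemma cone_spectral_radius_nonneg:
  assumes "proper_cone C"
  shows "0 \<le> cone_spectral_radius C g"
proof -
  have "0 \<le> limsup (\<lambda>k. ereal (root k (norm ((g ^^ k) 0))))"
    by (intro le_Limsup always_eventually allI) (auto intro: real_root_ge_zero)
  also have "\<dots> \<le> cone_spectral_radius C g"
    unfolding cone_spectral_radius_def by (rule SUP_upper[OF proper_cone_zero[OF assms]])
  finally show ?thesis .
qed

text \<open>Comparing \<open>g\<close> with \<open>h\<close> at the iterate of \<open>g\<close> and
  then using monotonicity of \<open>h\<close> orders the iterates; normality turns this into a norm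
  estimate up to a constant factor.\<close>

lemma cone_spectral_radius_mono:
  assumes C: "normal_cone C" and g: "homogeneous_map g" "order_preserving C g"
    and h: "order_preserving C h" and le: "\<And>x. cone_le C (g x) (h x)"
  shows "cone_spectral_radius C g \<le> cone_spectral_radius C h"
proof -
  have pC: "proper_cone C"
    using C by (simp add: normal_cone_def)
  obtain M where M: "M > 0" "\<And>x y. cone_le C 0 x \<Longrightarrow> cone_le C x y \<Longrightarrow> norm x \<le> M * norm y"
    using normal_coneE[OF C] by blast
  have iter: "cone_le C ((g ^^ k) x) ((h ^^ k) x)" for k x
  proof (induction k)
    case 0
    show ?case by (simp add: cone_le_refl pC)
  next
    case (Suc k)
    then show ?case
      using h le cone_le_trans[OF pC] unfolding order_preserving_def by fastforce
  qed
  show ?thesis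
    unfolding cone_spectral_radius_def
  proof (rule SUP_mono)
    fix x assume "x \<in> C"
    then have "norm ((g ^^ k) x) \<le> M * norm ((h ^^ k) x)" for k
      by (intro M iter funpow_nonneg g) (simp add: cone_le_def)
    then show "\<exists>y\<in>C. limsup (\<lambda>k. ereal (root k (norm ((g ^^ k) x))))
        \<le> limsup (\<lambda>k. ereal (root k (norm ((h ^^ k) y))))"
      using \<open>x \<in> C\<close> by (intro bexI[of _ x] limsup_root_le[OF M(1)])
  qed
qed

text \<open>An interior \<open>v\<close> with \<open>g v\<close> below \<open>l\<close> times
  \<open>v\<close> has a multiple \<open>w\<close> above any given \<open>x\<close>. Then the k-th
  iterate of \<open>x\<close> lies between 0 and \<open>l ^ k\<close> times \<open>w\<close>, and
  normality bounds its growth rate by \<open>l\<close>.\<close>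

lemma cone_spectral_radius_le_cw:
  assumes C: "normal_cone C" and g: "homogeneous_map g" "order_preserving C g"
  shows "cone_spectral_radius C g \<le> cw C g"
  unfolding cw_def cone_spectral_radius_def
proof (intro Inf_greatest SUP_least, safe)
  fix x v and l :: real
  assume x: "x \<in> C" and l: "l > 0" and v: "v \<in> interior C" "cone_le C (g v) (l *\<^sub>R v)"
  have pC: "proper_cone C"
    using C by (simp add: normal_cone_def)
  obtain M where M: "M > 0" "\<And>x y. cone_le C 0 x \<Longrightarrow> cone_le C x y \<Longrightarrow> norm x \<le> M * norm y"
    using normal_coneE[OF C] by blast
  obtain s where s: "s > 0" "order_unit C (s *\<^sub>R v)"
    using interior_order_unit[OF pC v(1)] .
  \<comment> \<open>The summand 1 keeps the factor positive for \<open>x = 0\<close>, so that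
    homogeneity applies to it.\<close>
  define w where "w = ((norm x + 1) * s) *\<^sub>R v"
  have v0: "cone_le C 0 v"
    using v(1) interior_subset by (auto simp: cone_le_def)
  have "cone_le C x ((norm x * s) *\<^sub>R v)"
    using s(2) unfolding order_unit_def by (metis scaleR_scaleR)
  moreover have "cone_le C ((norm x * s) *\<^sub>R v) w"
    unfolding w_def using s by (intro cone_le_scaleR_left pC v0) auto
  ultimately have xw: "cone_le C x w"
    using cone_le_trans[OF pC] by blast
  have pos: "(norm x + 1) * s > 0"
    using s(1) by (simp add: add_nonneg_pos)
  have gw: "cone_le C (g w) (l *\<^sub>R w)"
    using cone_le_scaleR[OF pC v(2), of "(norm x + 1) * s"] g(1) pos
    by (simp add: w_def homogeneous_map_def mult.commute)
  have iter: "cone_le C ((g ^^ k) w) (l ^ k *\<^sub>R w)" for k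
  proof (induction k)
    case 0
    show ?case by (simp add: cone_le_refl pC)
  next
    case (Suc k)
    then have "cone_le C ((g ^^ Suc k) w) (g (l ^ k *\<^sub>R w))"
      using g(2) by (simp add: order_preserving_def)
    moreover have "g (l ^ k *\<^sub>R w) = l ^ k *\<^sub>R g w"
      using g(1) l by (simp add: homogeneous_map_def)
    moreover have "cone_le C (l ^ k *\<^sub>R g w) (l ^ Suc k *\<^sub>R w)"
      using cone_le_scaleR[OF pC gw, of "l ^ k"] l by (simp add: mult.commute)
    ultimately show ?case
      using cone_le_trans[OF pC] by metis
  qed
  have "norm ((g ^^ k) x) \<le> (M * norm w + 1) * l ^ k" for k
  proof -
    have "norm ((g ^^ k) x) \<le> M * norm (l ^ k *\<^sub>R w)"
      using cone_le_trans[OF pC order_preserving_funpow[OF g(2) xw] iter] x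
      by (intro M funpow_nonneg g) (auto simp: cone_le_def)
    \<comment> \<open>Adding 1 keeps the constant positive even if \<open>w\<close> is zero.\<close>
    also have "\<dots> \<le> (M * norm w + 1) * l ^ k"
      using l by (simp add: algebra_simps)
    finally show ?thesis .
  qed
  moreover have "M * norm w + 1 > 0"
    using M(1) by (simp add: add_nonneg_pos)
  ultimately show "limsup (\<lambda>k. ereal (root k (norm ((g ^^ k) x)))) \<le> ereal l"
    using limsup_root_le[of "M * norm w + 1" _ "\<lambda>k. l ^ k"] limsup_root_power[of l] l by simp
qed

section \<open>Elementary bounds for the Collatz-Wielandt number\<close>

text \<open>The definition of \<open>cw\<close> admits positive factors only; here \<open>l\<close>
  may have any sign, and \<open>max l 0 + e\<close> is an admissible factor for every
  \<open>e > 0\<close>.\<close>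

lemma cw_le:
  assumes C: "proper_cone C" and x: "x \<in> interior C" "cone_le C (g x) (l *\<^sub>R x)"
  shows "cw C g \<le> ereal (max l 0)"
proof (rule ereal_le_epsilon2)
  fix e :: real assume e: "e > 0"
  have "cone_le C 0 x"
    using x(1) interior_subset by (auto simp: cone_le_def)
  then have "cone_le C (l *\<^sub>R x) ((max l 0 + e) *\<^sub>R x)"
    using e by (intro cone_le_scaleR_left C) auto
  then have "cone_le C (g x) ((max l 0 + e) *\<^sub>R x)"
    using cone_le_trans[OF C x(2)] by blast
  moreover have "max l 0 + e > 0"
    using e by linarith
  ultimately show "cw C g \<le> ereal (max l 0) + ereal e"
    unfolding cw_def plus_ereal.simps using x(1) by (intro Inf_lower) blast
qed

lemma cw_nonneg: "0 \<le> cw C g"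
  unfolding cw_def by (intro Inf_greatest) auto

lemma cw_less_infinity:
  assumes "proper_cone C" "interior C \<noteq> {}"
  shows "cw C g < \<infinity>"
proof -
  obtain v where v: "v \<in> interior C"
    using assms(2) by blast
  obtain s where "order_unit C (s *\<^sub>R v)"
    using interior_order_unit[OF assms(1) v] by blast
  then have "cone_le C (g v) ((norm (g v) * s) *\<^sub>R v)"
    unfolding order_unit_def by (metis scaleR_scaleR)
  then have "cw C g \<le> ereal (max (norm (g v) * s) 0)"
    by (rule cw_le[OF assms(1) v])
  then show ?thesis
    by (rule order.strict_trans1) (simp add: max_def)
qed

section \<open>Almost fixed points and approximate eigenvectors\<close>

text \<open>A subeigenvalue \<open>m\<close> strictly below \<open>l\<close> yields \<open>v\<close>
  with \<open>g v\<close> below \<open>v\<close>, which traps the increasing orbit of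
  \<open>u\<close> between \<open>u\<close> and \<open>R\<close> times \<open>u\<close>. This makes
  the excess over 1 in the ratio of successive iterates shrink by the factor
  \<open>1 - 1 / R\<close>.\<close>

lemma almost_fixed_point:
  assumes C: "proper_cone C" and f: "homogeneous_map f" "order_preserving C f"
    and u: "order_unit C u" and l: "cw C f < ereal l" and t: "1 < t"
  obtains x where "cone_le C u x"
    "cone_le C x ((1 / l) *\<^sub>R f x + u)" "cone_le C ((1 / l) *\<^sub>R f x + u) (t *\<^sub>R x)"
proof -
  obtain m v0 where m: "0 < m" "m < l" and v0: "v0 \<in> interior C" "cone_le C (f v0) (m *\<^sub>R v0)"
    using l unfolding cw_def Inf_less_iff by auto
  define g where "g x = (1 / l) *\<^sub>R f x + u" for x
  have g_mono: "cone_le C (g x) (g y)" if "cone_le C x y" for x y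
    unfolding g_def using that f(2) m
    by (intro cone_le_add cone_le_scaleR cone_le_refl C) (auto simp: order_preserving_def)
  have u0: "cone_le C 0 u"
    by (rule order_unit_nonneg[OF C u])
  have v00: "cone_le C 0 v0"
    using v0(1) interior_subset by (auto simp: cone_le_def)
  obtain s where s: "s > 0" "order_unit C (s *\<^sub>R v0)"
    using interior_order_unit[OF C v0(1)] .
  \<comment> \<open>The last factor is the inverse of \<open>1 - m / l\<close>, so
    \<open>1 - m / l\<close> times \<open>v\<close> still dominates \<open>u\<close>.\<close>
  define b where "b = (norm u + 1) * s * (l / (l - m))"
  define v where "v = b *\<^sub>R v0"
  have b: "b > 0"
    unfolding b_def using s(1) m by (intro mult_pos_pos) (auto simp: add_nonneg_pos)
  have fv: "cone_le C (f v) (m *\<^sub>R v)"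
    using cone_le_scaleR[OF C v0(2), of b] f(1) b
    by (simp add: v_def homogeneous_map_def mult.commute)
  have uv: "cone_le C u ((1 - m / l) *\<^sub>R v)"
  proof -
    have "cone_le C u ((norm u * s) *\<^sub>R v0)"
      using s(2) unfolding order_unit_def by (metis scaleR_scaleR)
    moreover have "cone_le C ((norm u * s) *\<^sub>R v0) (((norm u + 1) * s) *\<^sub>R v0)"
      using s by (intro cone_le_scaleR_left C v00) auto
    moreover have "(1 - m / l) *\<^sub>R v = ((norm u + 1) * s) *\<^sub>R v0"
    proof -
      have "(1 - m / l) * b = ((norm u + 1) * s) * ((1 - m / l) * (l / (l - m)))"
        unfolding b_def by (simp only: mult_ac)
      also have "(1 - m / l) * (l / (l - m)) = 1"
        using m by (simp add: field_simps)
      finally show ?thesis by (simp add: v_def)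
    qed
    ultimately show ?thesis
      using cone_le_trans[OF C] by metis
  qed
  \<comment> \<open>The bounds for \<open>f v / l\<close> and \<open>u\<close> are the fractions
    \<open>m / l\<close> and \<open>1 - m / l\<close> of \<open>v\<close>.\<close>
  have gv: "cone_le C (g v) v"
  proof -
    have "cone_le C (g v) ((1 / l) *\<^sub>R (m *\<^sub>R v) + (1 - m / l) *\<^sub>R v)"
      unfolding g_def using m by (intro cone_le_add cone_le_scaleR C fv uv) auto
    then show ?thesis by (simp add: algebra_simps)
  qed
  define X where "X k = (g ^^ k) u" for k
  have X0: "X 0 = u" and XS: "X (Suc k) = g (X k)" for k
    by (auto simp: X_def)
  have g_ge_u: "cone_le C u (g x)" if "cone_le C 0 x" for x
  proof -
    have "cone_le C 0 (f x)"
      using funpow_nonneg[OF f that, of 1] by simp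
    then have "cone_le C (0 + u) (g x)"
      unfolding g_def using cone_le_scaleR[OF C, of 0 "f x" "1 / l"] m
      by (intro cone_le_add cone_le_refl C) auto
    then show ?thesis by simp
  qed
  have v_nonneg: "cone_le C 0 v"
    using cone_le_scaleR[OF C v00, of b] b by (simp add: v_def)
  have Xu: "cone_le C u (X k)" for k
  proof (induction k)
    case 0
    show ?case by (simp add: X0 cone_le_refl C)
  next
    case (Suc k)
    show ?case
      unfolding XS by (intro g_ge_u cone_le_trans[OF C u0 Suc])
  qed
  have Xv: "cone_le C (X k) v" for k
  proof (induction k)
    case 0
    show ?case
      unfolding X0 by (rule cone_le_trans[OF C g_ge_u[OF v_nonneg] gv])
  next
    case (Suc k)
    show ?case
      unfolding XS by (rule cone_le_trans[OF C g_mono[OF Suc] gv])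
  qed
  have incr: "cone_le C (X k) (X (Suc k))" for k
  proof (induction k)
    case 0
    show ?case unfolding XS unfolding X0 by (rule g_ge_u[OF u0])
  next
    case (Suc k)
    then show ?case unfolding XS by (rule g_mono)
  qed
  \<comment> \<open>The summand 1 gives \<open>R >= 1\<close>, hence a ratio \<open>q\<close> in [0,
    1).\<close>
  define R where "R = norm v + 1"
  have R: "R \<ge> 1"
    by (simp add: R_def)
  have XR: "cone_le C (X k) (R *\<^sub>R u)" for k
  proof -
    have "cone_le C v (norm v *\<^sub>R u)"
      using u by (simp add: order_unit_def)
    moreover have "cone_le C (norm v *\<^sub>R u) (R *\<^sub>R u)"
      unfolding R_def by (intro cone_le_scaleR_left C u0) auto
    ultimately show ?thesis
      using Xv cone_le_trans[OF C] by blast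
  qed
  define q where "q = 1 - 1 / R"
  have q: "0 \<le> q" "q < 1"
    using R by (auto simp: q_def)
  \<comment> \<open>Initial excess: \<open>g u\<close> lies below \<open>T\<close> times
    \<open>u\<close> by the unit property.\<close>
  define T where "T = norm (g u)"
  have ratio: "cone_le C (X (Suc k)) ((1 + T * q ^ k) *\<^sub>R X k)" for k
  proof (induction k)
    case 0
    have "cone_le C (0 + g u) (u + T *\<^sub>R u)"
      using u unfolding T_def by (intro cone_le_add C u0) (simp add: order_unit_def)
    then show ?case by (simp add: XS X0 algebra_simps)
  next
    case (Suc k)
    define d where "d = T * q ^ k"
    have d: "d \<ge> 0"
      using q by (simp add: d_def T_def)
    have "cone_le C (g (X (Suc k))) (g ((1 + d) *\<^sub>R X k))"
      using Suc by (intro g_mono) (simp add: d_def)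
    \<comment> \<open>Scaling acts on the \<open>f\<close> part only; the translation by
      \<open>u\<close> is not scaled, which leaves a gain of \<open>d\<close> times
      \<open>u\<close>.\<close>
    moreover have "g ((1 + d) *\<^sub>R X k) = (1 + d) *\<^sub>R g (X k) - d *\<^sub>R u"
    proof -
      have "f ((1 + d) *\<^sub>R X k) = (1 + d) *\<^sub>R f (X k)"
        using f(1) d by (simp add: homogeneous_map_def)
      then show ?thesis
        unfolding g_def by (simp only:) (simp add: algebra_simps add_divide_distrib)
    qed
    \<comment> \<open>The gain absorbs the fraction \<open>1 / R\<close> of the excess, because
      \<open>u\<close> dominates \<open>X (Suc k) / R\<close>.\<close>
    moreover have "cone_le C ((1 + d) *\<^sub>R g (X k) - d *\<^sub>R u) ((1 + d * q) *\<^sub>R g (X k))"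
    proof -
      have "cone_le C ((d / R) *\<^sub>R X (Suc k)) ((d / R) *\<^sub>R (R *\<^sub>R u))"
        using d R by (intro cone_le_scaleR C XR) auto
      then have "cone_le C ((d / R) *\<^sub>R g (X k)) (d *\<^sub>R u)"
        using R by (simp add: XS)
      then show ?thesis
        unfolding cone_le_def q_def by (simp add: algebra_simps)
    qed
    ultimately have "cone_le C (X (Suc (Suc k))) ((1 + d * q) *\<^sub>R X (Suc k))"
      unfolding XS using cone_le_trans[OF C] by metis
    then show ?case
      by (simp add: d_def mult_ac)
  qed
  have "(\<lambda>k. T * q ^ k) \<longlonglongrightarrow> T * 0"
    using q by (intro tendsto_mult tendsto_const LIMSEQ_realpow_zero)
  then have "\<forall>\<^sub>F k in sequentially. T * q ^ k < t - 1"
    using t by (intro order_tendstoD(2)) auto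
  then obtain k where k: "T * q ^ k < t - 1"
    using eventually_happens by force
  have "cone_le C ((1 + T * q ^ k) *\<^sub>R X k) (t *\<^sub>R X k)"
    using k by (intro cone_le_scaleR_left C cone_le_trans[OF C u0 Xu]) auto
  then have "cone_le C (X (Suc k)) (t *\<^sub>R X k)"
    using cone_le_trans[OF C ratio] by blast
  then show ?thesis
    using that[OF Xu[of k]] incr[of k] by (simp add: XS g_def)
qed

text \<open>The vector is the normalised almost fixed point. Its error splits into a part from
  \<open>l - c\<close>, a part from \<open>t - 1\<close> controlled by normality, and a part from
  the translation by \<open>u\<close>, which is small because \<open>norm x\<close> is
  large.\<close>

lemma approximate_eigenvector:
  assumes C: "normal_cone C" "interior C \<noteq> {}"
    and f: "homogeneous_map f" "order_preserving C f"
    and c: "cw C f = ereal c" "0 < c" and e: "0 < e"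
  obtains y where "y \<in> C" "norm y = 1" "norm (f y - c *\<^sub>R y) \<le> e"
proof -
  have pC: "proper_cone C"
    using C(1) by (simp add: normal_cone_def)
  obtain M where M: "M > 0" "\<And>x y. cone_le C 0 x \<Longrightarrow> cone_le C x y \<Longrightarrow> norm x \<le> M * norm y"
    using normal_coneE[OF C(1)] by blast
  obtain u where u: "order_unit C u"
    using C(2) interior_order_unit[OF pC] by blast
  \<comment> \<open>Chosen together with \<open>d\<close> so that
    \<open>(l - c) * (1 + norm u)\<close> and \<open>d * l * (M + norm u)\<close>, which sum to the
    final bound, are \<open>e / 2\<close> each.\<close>
  define l where "l = c + e / (2 * (1 + norm u))"
  define d where "d = e / (2 * l * (M + norm u))"
  have nu: "1 + norm u > 0" "M + norm u > 0"
    using M(1) by (auto simp: add_pos_nonneg)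
  have l: "l > c"
    unfolding l_def using e nu by simp
  have d: "d > 0"
    unfolding d_def using e nu l c(2) by simp
  define t where "t = 1 + d"
  obtain x where x: "cone_le C u x" "cone_le C x ((1 / l) *\<^sub>R f x + u)"
      "cone_le C ((1 / l) *\<^sub>R f x + u) (t *\<^sub>R x)"
    using almost_fixed_point[OF pC f u, of l t] c(1) l d by (auto simp: t_def)
  define z where "z = (1 / l) *\<^sub>R f x + u"
  have fx: "f x = l *\<^sub>R (z - u)"
    using l c(2) by (simp add: z_def)
  have xi: "x \<in> interior C"
    by (intro order_unit_interior order_unit_mono[OF pC u x(1)] pC)
  have x0: "cone_le C 0 x"
    using xi interior_subset by (auto simp: cone_le_def)
  \<comment> \<open>If the interior point \<open>x\<close> were 0, it would be a subeigenvector with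
    factor 0, forcing \<open>cw C f = 0\<close>.\<close>
  have "x \<noteq> 0"
  proof
    assume "x = 0"
    then have "cone_le C (f x) (0 *\<^sub>R x)"
      by (simp add: homogeneous_map_zero[OF f(1)] cone_le_refl pC)
    then show False
      using cw_le[OF pC xi] c by fastforce
  qed
  then have n: "norm x > 0" by simp
  \<comment> \<open>Subtracting \<open>u\<close> lowers the factor \<open>t\<close> by
    \<open>1 / norm x\<close>, since \<open>u\<close> dominates \<open>x / norm x\<close>.\<close>
  have "cone_le C (f x) ((l * (t - 1 / norm x)) *\<^sub>R x)"
  proof -
    have "cone_le C ((1 / norm x) *\<^sub>R x) ((1 / norm x) *\<^sub>R (norm x *\<^sub>R u))"
      using u by (intro cone_le_scaleR pC) (auto simp: order_unit_def)
    then have "cone_le C ((1 / norm x) *\<^sub>R x) u"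
      using n by simp
    then have "cone_le C (z + (1 / norm x) *\<^sub>R x) (t *\<^sub>R x + u)"
      using x(3) by (intro cone_le_add pC) (auto simp: z_def)
    then have "cone_le C (z - u) ((t - 1 / norm x) *\<^sub>R x)"
      by (simp add: cone_le_def algebra_simps)
    then have "cone_le C (l *\<^sub>R (z - u)) (l *\<^sub>R ((t - 1 / norm x) *\<^sub>R x))"
      using l c(2) by (intro cone_le_scaleR pC) auto
    then show ?thesis
      by (simp add: fx)
  qed
  from cw_le[of C x f, OF pC xi this] have "c \<le> max (l * (t - 1 / norm x)) 0"
    unfolding c(1) by (simp only: ereal_less_eq)
  then have "c \<le> l * (t - 1 / norm x)"
    using c(2) by (simp add: max_def split: if_splits)
  \<comment> \<open>This bounds \<open>norm x\<close> from below: the right-hand side tends to 0 as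
    \<open>l\<close> tends to \<open>c\<close> and \<open>t\<close> to 1.\<close>
  then have large: "l * (1 / norm x) \<le> l * t - c"
    by (simp add: right_diff_distrib)
  \<comment> \<open>The difference \<open>z - x\<close> lies between 0 and \<open>d\<close> times
    \<open>x\<close>, so normality applies.\<close>
  have zx: "norm (z - x) \<le> M * (d * norm x)"
  proof -
    have "norm (z - x) \<le> M * norm (d *\<^sub>R x)"
      using x(2,3) by (intro M) (auto simp: cone_le_def z_def t_def algebra_simps)
    then show ?thesis
      using d by simp
  qed
  define y where "y = (1 / norm x) *\<^sub>R x"
  have "f y = (1 / norm x) *\<^sub>R f x"
    using f(1) n by (simp add: y_def homogeneous_map_def)
  also have "\<dots> = (l / norm x) *\<^sub>R (z - u)"
    by (simp add: fx)
  finally have "f y - c *\<^sub>R y = (l - c) *\<^sub>R y + (l / norm x) *\<^sub>R (z - x) - (l / norm x) *\<^sub>R u"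
    by (simp add: y_def algebra_simps diff_divide_distrib)
  also have "norm \<dots> \<le> norm ((l - c) *\<^sub>R y) + norm ((l / norm x) *\<^sub>R (z - x)) + norm ((l / norm x) *\<^sub>R u)"
    by (meson add_right_mono norm_triangle_ineq norm_triangle_ineq4 order_trans)
  also have "\<dots> \<le> (l - c) + l * M * d + (l * t - c) * norm u"
  proof (intro add_mono)
    show "norm ((l - c) *\<^sub>R y) \<le> l - c"
      using l n by (simp add: y_def)
    show "norm ((l / norm x) *\<^sub>R (z - x)) \<le> l * M * d"
    proof -
      have "norm ((l / norm x) *\<^sub>R (z - x)) = (l / norm x) * norm (z - x)"
        using l c(2) by simp
      also have "\<dots> \<le> (l / norm x) * (M * (d * norm x))"
        using l c(2) by (intro mult_left_mono zx) auto
      also have "\<dots> = l * M * d"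
        using n by simp
      finally show ?thesis .
    qed
    show "norm ((l / norm x) *\<^sub>R u) \<le> (l * t - c) * norm u"
      using mult_right_mono[OF large, of "norm u"] l c(2) by simp
  qed
  also have "\<dots> = (l - c) * (1 + norm u) + d * l * (M + norm u)"
    by (simp add: t_def algebra_simps)
  also have "\<dots> = e"
  proof -
    have "(l - c) * (1 + norm u) = e / 2"
      unfolding l_def using nu by (simp add: field_simps)
    moreover have "d * l * (M + norm u) = e / 2"
    proof -
      have "e / (2 * l * K) * l * K = e / 2" if "K > 0" for K
        using that l c(2) by (simp add: field_simps)
      from this[OF nu(2)] show ?thesis
        by (simp only: d_def)
    qed
    ultimately show ?thesis by simp
  qed
  finally have "norm (f y - c *\<^sub>R y) \<le> e" .
  moreover have "norm y = 1"
    using n by (simp add: y_def)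
  moreover have "y \<in> C"
    using x0 proper_cone_scaleR[OF pC, of "1 / norm x" x] by (simp add: y_def cone_le_def)
  ultimately show ?thesis
    using that by blast
qed

section \<open>Eigenvectors under the noncompactness condition\<close>

lemma homogeneous_mncD:
  assumes "homogeneous_mnc \<nu>" and "bounded A"
  shows "0 \<le> \<nu> A"
    and "\<nu> A = 0 \<longleftrightarrow> compact (closure A)"
    and "bounded B \<Longrightarrow> \<nu> {x + y | x y. x \<in> A \<and> y \<in> B} \<le> \<nu> A + \<nu> B"
    and "\<nu> ((*\<^sub>R) c ` A) = \<bar>c\<bar> * \<nu> A"
    and "bounded B \<Longrightarrow> A \<subseteq> B \<Longrightarrow> \<nu> A \<le> \<nu> B"
  using assms by (simp_all add: homogeneous_mnc_def)

text \<open>The errors \<open>w n\<close> form a relatively compact set, of measure 0. Writing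
  \<open>c\<close> times \<open>y n\<close> as \<open>f (y n) + w n\<close> bounds \<open>c\<close>
  times the measure of the range by \<open>l\<close> times that measure; as \<open>l < c\<close>,
  the measure is 0.\<close>

lemma homogeneous_mnc_sequence_compact:
  fixes y :: "nat \<Rightarrow> 'a::real_normed_vector"
  assumes nu: "homogeneous_mnc \<nu>" and c: "0 < c" "l < c"
    and y: "bounded (range y)"
    and le: "\<nu> (f ` range y) \<le> l * \<nu> (range y)"
    and lim: "(\<lambda>n. f (y n) - c *\<^sub>R y n) \<longlonglongrightarrow> 0"
  shows "compact (closure (range y))"
proof -
  define w where "w n = c *\<^sub>R y n - f (y n)" for n
  have w: "w \<longlonglongrightarrow> 0"
    using tendsto_minus[OF lim] by (simp add: w_def[abs_def])
  have com: "compact (insert 0 (range w))"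
    using compactin_sequence_with_limit[of euclidean w 0 "range w"] w by simp
  then have "closure (range w) \<subseteq> insert 0 (range w)"
    by (intro closure_minimal) (auto intro: compact_imp_closed)
  then have clw: "compact (closure (range w))"
    using compact_Int_closed[OF com closed_closure[of "range w"]] by (simp only: Int_absorb1)
  then have bw: "bounded (range w)"
    using bounded_subset[OF compact_imp_bounded closure_subset] by blast
  then have w0: "\<nu> (range w) = 0"
    using homogeneous_mncD(2)[OF nu bw] clw by simp
  have bcy: "bounded ((*\<^sub>R) c ` range y)"
    using y by (rule bounded_scaling)
  have bfy: "bounded (f ` range y)"
  proof -
    have "f ` range y = range (\<lambda>n. c *\<^sub>R y n - w n)"
      by (simp add: w_def image_image)
    moreover have "bounded (range (\<lambda>n. c *\<^sub>R y n - w n))"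
      using bcy bw by (intro bounded_minus_comp) (simp_all add: image_image)
    ultimately show ?thesis by simp
  qed
  have "(*\<^sub>R) c ` range y \<subseteq> {a + b | a b. a \<in> f ` range y \<and> b \<in> range w}"
  proof safe
    fix n
    have "c *\<^sub>R y n = f (y n) + w n"
      by (simp add: w_def)
    then show "\<exists>a b. c *\<^sub>R y n = a + b \<and> a \<in> f ` range y \<and> b \<in> range w"
      by blast
  qed
  moreover have "bounded {a + b | a b. a \<in> f ` range y \<and> b \<in> range w}"
    by (rule bounded_subset[OF bounded_sums[OF bfy bw]]) blast
  ultimately have "\<nu> ((*\<^sub>R) c ` range y) \<le> \<nu> {a + b | a b. a \<in> f ` range y \<and> b \<in> range w}"
    by (intro homogeneous_mncD(5)[OF nu bcy])
  also have "\<dots> \<le> \<nu> (f ` range y) + \<nu> (range w)"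
    by (rule homogeneous_mncD(3)[OF nu bfy bw])
  finally have "c * \<nu> (range y) \<le> l * \<nu> (range y)"
    using homogeneous_mncD(4)[OF nu y, of c] c(1) le w0 by simp
  then have "(c - l) * \<nu> (range y) \<le> 0"
    by (simp add: left_diff_distrib)
  then have "\<nu> (range y) \<le> 0"
    using c(2) by (simp add: mult_le_0_iff)
  then show ?thesis
    using homogeneous_mncD(1,2)[OF nu y] by simp
qed

text \<open>Approximate eigenvectors with errors tending to 0 have a convergent subsequence. Its
  limit stays in \<open>C\<close>, has norm 1 and is an exact eigenvector for \<open>c\<close>, so
  its orbit grows like \<open>c ^ k\<close>.\<close>

lemma cw_le_cone_spectral_radius_mnc:
  assumes nu: "homogeneous_mnc \<nu>" and C: "normal_cone C" "interior C \<noteq> {}"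
    and f: "homogeneous_map f" "order_preserving C f" "continuous_on UNIV f"
    and c: "cw C f = ereal c" "0 < c" and less: "mnc_coeff \<nu> C f < ereal c"
  shows "ereal c \<le> cone_spectral_radius C f"
proof -
  obtain l where l: "l < c" "\<And>A. bounded A \<Longrightarrow> A \<subseteq> C \<Longrightarrow> \<nu> (f ` A) \<le> l * \<nu> A"
    using less unfolding mnc_coeff_def Inf_less_iff by auto
  have "\<exists>y\<in>C. norm y = 1 \<and> norm (f y - c *\<^sub>R y) \<le> inverse (real (Suc n))" for n
    using approximate_eigenvector[OF C f(1,2) c, of "inverse (real (Suc n))"] by auto
  then obtain y where y: "\<And>n. y n \<in> C" "\<And>n. norm (y n) = 1"
      "\<And>n. norm (f (y n) - c *\<^sub>R y n) \<le> inverse (real (Suc n))"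
    by metis
  have bnd: "bounded (range y)"
    unfolding bounded_iff using y(2) by auto
  have lim: "(\<lambda>n. f (y n) - c *\<^sub>R y n) \<longlonglongrightarrow> 0"
    by (rule Lim_null_comparison[OF _ LIMSEQ_inverse_real_of_nat]) (use y(3) in auto)
  have "compact (closure (range y))"
    using y(1) by (intro homogeneous_mnc_sequence_compact[OF nu c(2) l(1) bnd _ lim] l(2) bnd) auto
  moreover have "\<forall>n. y n \<in> closure (range y)"
    by (simp add: closure_subset[THEN subsetD])
  ultimately obtain z r where z: "strict_mono r" "(y \<circ> r) \<longlonglongrightarrow> z"
    unfolding compact_def by meson
  have "z \<in> C"
    using C(1) y(1) z(2) unfolding normal_cone_def proper_cone_def
    by (metis closed_sequentially comp_apply)
  have "norm z = 1"
    using tendsto_norm[OF z(2)] y(2) by (simp add: LIMSEQ_const_iff)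
  have "(\<lambda>n. f ((y \<circ> r) n) - c *\<^sub>R (y \<circ> r) n) \<longlonglongrightarrow> f z - c *\<^sub>R z"
    using f(3) z(2) by (intro tendsto_intros continuous_on_tendsto_compose[OF f(3)]) (auto simp: o_def)
  moreover have "(\<lambda>n. f ((y \<circ> r) n) - c *\<^sub>R (y \<circ> r) n) \<longlonglongrightarrow> 0"
    using LIMSEQ_subseq_LIMSEQ[OF lim z(1)] by (simp add: o_def)
  ultimately have "f z = c *\<^sub>R z"
    using LIMSEQ_unique by fastforce
  then have iter: "(f ^^ k) z = c ^ k *\<^sub>R z" for k
    using f(1) c(2) by (induction k) (auto simp: homogeneous_map_def mult.commute)
  show ?thesis
    using c(2) \<open>norm z = 1\<close>
    by (intro cone_spectral_radius_ge[OF \<open>z \<in> C\<close>, of 1]) (auto simp: iter)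
qed

section \<open>Approximate orbits under uniform continuity\<close>

text \<open>If the k-th iterate is close to \<open>c ^ k\<close> times \<open>y\<close>, uniform
  continuity makes the next one close to \<open>c ^ k\<close> times \<open>f y\<close>, hence to
  \<open>c ^ Suc k\<close> times \<open>y\<close>. Uniformity makes \<open>d\<close> independent of
  \<open>y\<close>.\<close>

lemma approximate_eigenvector_funpow:
  assumes f: "homogeneous_map f" "f ` C \<subseteq> C" and C: "proper_cone C"
    and unif: "\<And>B. bounded B \<Longrightarrow> B \<subseteq> C \<Longrightarrow> uniformly_continuous_on B f"
    and c: "0 < c" and e: "0 < e"
  shows "\<exists>d>0. \<forall>y\<in>C. norm y = 1 \<longrightarrow> norm (f y - c *\<^sub>R y) \<le> d \<longrightarrow>
    norm ((f ^^ k) y - c ^ k *\<^sub>R y) \<le> e"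
  using e
proof (induction k arbitrary: e)
  case 0
  then show ?case by (auto intro: exI[of _ 1])
next
  case (Suc k)
  \<comment> \<open>Radius for unit \<open>y\<close>: it covers \<open>c ^ k\<close> times
    \<open>y\<close> and every point within distance 1 of it.\<close>
  define B where "B = C \<inter> cball 0 (c ^ k + 1)"
  have "uniformly_continuous_on B f"
    by (intro unif) (auto simp: B_def)
  then obtain d1 where d1: "d1 > 0" "\<And>x x'. x \<in> B \<Longrightarrow> x' \<in> B \<Longrightarrow> dist x' x < d1 \<Longrightarrow> dist (f x') (f x) < e / 2"
    unfolding uniformly_continuous_on_def using Suc.prems by (metis half_gt_zero)
  \<comment> \<open>Half of \<open>d1\<close> gives the strict inequality of uniform continuity; the
    bound 1 keeps the iterate inside \<open>B\<close>.\<close>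
  have "min (d1 / 2) 1 > 0"
    using d1(1) by simp
  then obtain d2 where d2: "d2 > 0" "\<And>y. y \<in> C \<Longrightarrow> norm y = 1 \<Longrightarrow> norm (f y - c *\<^sub>R y) \<le> d2 \<Longrightarrow>
      norm ((f ^^ k) y - c ^ k *\<^sub>R y) \<le> min (d1 / 2) 1"
    using Suc.IH by blast
  define d where "d = min d2 (e / (2 * c ^ k))"
  have "d > 0"
    using d2(1) Suc.prems c by (simp add: d_def)
  moreover have "norm ((f ^^ Suc k) y - c ^ Suc k *\<^sub>R y) \<le> e"
    if y: "y \<in> C" "norm y = 1" "norm (f y - c *\<^sub>R y) \<le> d" for y
  proof -
    have close: "norm ((f ^^ k) y - c ^ k *\<^sub>R y) \<le> min (d1 / 2) 1"
      using y by (intro d2) (auto simp: d_def)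
    have "(f ^^ k) y \<in> C"
      using y(1) f(2) by (induction k) auto
    moreover have "norm ((f ^^ k) y) \<le> c ^ k + 1"
      using norm_triangle_ineq2[of "(f ^^ k) y" "c ^ k *\<^sub>R y"] close y(2) c by simp
    ultimately have "(f ^^ k) y \<in> B"
      by (simp add: B_def)
    moreover have "c ^ k *\<^sub>R y \<in> B"
      using y c proper_cone_scaleR[OF C, of "c ^ k" y] by (simp add: B_def)
    ultimately have "dist (f ((f ^^ k) y)) (f (c ^ k *\<^sub>R y)) < e / 2"
      using close d1(1) by (intro d1) (auto simp: dist_norm)
    moreover have "f (c ^ k *\<^sub>R y) = c ^ k *\<^sub>R f y"
      using f(1) c by (simp add: homogeneous_map_def)
    ultimately have 1: "norm ((f ^^ Suc k) y - c ^ k *\<^sub>R f y) \<le> e / 2"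
      by (simp add: dist_norm)
    have "c ^ k * norm (f y - c *\<^sub>R y) \<le> c ^ k * (e / (2 * c ^ k))"
      using y(3) c by (intro mult_left_mono) (auto simp: d_def)
    then have 2: "norm (c ^ k *\<^sub>R (f y - c *\<^sub>R y)) \<le> e / 2"
      using c by simp
    have eq: "(f ^^ Suc k) y - c ^ Suc k *\<^sub>R y =
        ((f ^^ Suc k) y - c ^ k *\<^sub>R f y) + c ^ k *\<^sub>R (f y - c *\<^sub>R y)"
      by (simp add: algebra_simps)
    show ?thesis
      unfolding eq using norm_triangle_mono[OF 1 2] by (simp only: field_sum_of_halves)
  qed
  ultimately show ?case by blast
qed

text \<open>The approximate eigenvector depends on \<open>k\<close> and the error, but the order
  unit \<open>u\<close> dominates all unit vectors. So the single orbit of \<open>u\<close> inherits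
  every lower bound, and for fixed \<open>k\<close> the error tends to 0.\<close>

lemma cw_le_cone_spectral_radius_uniform:
  assumes C: "normal_cone C" "interior C \<noteq> {}"
    and f: "homogeneous_map f" "order_preserving C f"
    and unif: "\<And>B. bounded B \<Longrightarrow> B \<subseteq> C \<Longrightarrow> uniformly_continuous_on B f"
    and c: "cw C f = ereal c" "0 < c"
  shows "ereal c \<le> cone_spectral_radius C f"
proof -
  have pC: "proper_cone C"
    using C(1) by (simp add: normal_cone_def)
  have fC: "f ` C \<subseteq> C"
    using funpow_nonneg[OF f, of _ 1] by (auto simp: cone_le_def)
  obtain M where M: "M > 0" "\<And>x y. cone_le C 0 x \<Longrightarrow> cone_le C x y \<Longrightarrow> norm x \<le> M * norm y"
    using normal_coneE[OF C(1)] by blast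
  obtain u where u: "order_unit C u"
    using C(2) interior_order_unit[OF pC] by blast
  have "c ^ k \<le> M * norm ((f ^^ k) u)" for k
  proof (rule field_le_epsilon)
    fix e :: real assume "e > 0"
    then obtain d where d: "d > 0" "\<And>y. y \<in> C \<Longrightarrow> norm y = 1 \<Longrightarrow> norm (f y - c *\<^sub>R y) \<le> d \<Longrightarrow>
        norm ((f ^^ k) y - c ^ k *\<^sub>R y) \<le> e"
      using approximate_eigenvector_funpow[OF f(1) fC pC unif c(2)] by metis
    obtain y where y: "y \<in> C" "norm y = 1" "norm (f y - c *\<^sub>R y) \<le> d"
      using approximate_eigenvector[OF C f c d(1)] .
    have "cone_le C y (norm y *\<^sub>R u)"
      using u by (simp add: order_unit_def)
    then have "cone_le C ((f ^^ k) y) ((f ^^ k) u)"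
      using y(2) by (intro order_preserving_funpow f) simp
    then have "norm ((f ^^ k) y) \<le> M * norm ((f ^^ k) u)"
      using y(1) by (intro M funpow_nonneg f) (simp add: cone_le_def)
    moreover have "c ^ k - norm ((f ^^ k) y) \<le> e"
      using d(2)[OF y] norm_triangle_ineq2[of "c ^ k *\<^sub>R y" "(f ^^ k) y"] y(2) c(2)
      by (simp add: norm_minus_commute)
    ultimately show "c ^ k \<le> M * norm ((f ^^ k) u) + e" by linarith
  qed
  then show ?thesis
    using c(2) order_unit_nonneg[OF pC u]
    by (intro cone_spectral_radius_ge[of u C M]) (auto simp: M(1) cone_le_def)
qed

section \<open>The two conditions combined\<close>

text \<open>Approximate eigenvectors are available for positive \<open>c\<close>; for
  \<open>c = 0\<close> nonnegativity of the spectral radius suffices.\<close>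

lemma cw_le_cone_spectral_radius:
  assumes nu: "homogeneous_mnc \<nu>" and C: "normal_cone C" "interior C \<noteq> {}"
    and f: "homogeneous_map f" "order_preserving C f" "continuous_on UNIV f"
    and cond: "mnc_coeff \<nu> C f < cw C f \<or>
      (\<forall>B. bounded B \<and> B \<subseteq> C \<longrightarrow> uniformly_continuous_on B f)"
  shows "cw C f \<le> cone_spectral_radius C f"
proof -
  have pC: "proper_cone C"
    using C(1) by (simp add: normal_cone_def)
  obtain c where c: "cw C f = ereal c" "c \<ge> 0"
    using cw_nonneg[of C f] cw_less_infinity[OF pC C(2), of f] by (cases "cw C f") auto
  show ?thesis
  proof (cases "c = 0")
    case True
    then show ?thesis
      using c(1) cone_spectral_radius_nonneg[OF pC, of f] by (simp add: zero_ereal_def)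
  next
    case False
    then have "c > 0" using c(2) by simp
    then show ?thesis
      using cond cw_le_cone_spectral_radius_mnc[OF nu C f c(1)]
        cw_le_cone_spectral_radius_uniform[OF C f(1,2) _ c(1)] c(1) by metis
  qed
qed

section \<open>Infima of families with a lower selection\<close>

lemma infimum_map_attained:
  assumes "admits_lower_selection C \<A> F"
  obtains a where "a \<in> \<A>" "infimum_map C \<A> F x = F a x"
    "\<And>b. b \<in> \<A> \<Longrightarrow> cone_le C (infimum_map C \<A> F x) (F b x)"
proof -
  define a where "a = (SOME a. a \<in> \<A> \<and> (\<forall>b\<in>\<A>. cone_le C (F a x) (F b x)))"
  have "a \<in> \<A> \<and> (\<forall>b\<in>\<A>. cone_le C (F a x) (F b x))"
    unfolding a_def using assms unfolding admits_lower_selection_def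
    by (intro someI_ex[of "\<lambda>a. a \<in> \<A> \<and> (\<forall>b\<in>\<A>. cone_le C (F a x) (F b x))"]) blast
  then show ?thesis
    by (intro that[of a]) (auto simp: infimum_map_def a_def)
qed

text \<open>The indices selected at a point and at its multiple may differ; comparing each with the
  other gives two inequalities, and antisymmetry concludes.\<close>

lemma homogeneous_infimum_map:
  assumes C: "proper_cone C" and sel: "admits_lower_selection C \<A> F"
    and F: "\<And>a. a \<in> \<A> \<Longrightarrow> homogeneous_map (F a)"
  shows "homogeneous_map (infimum_map C \<A> F)"
  unfolding homogeneous_map_def
proof (intro allI impI)
  fix t :: real and x assume t: "t > 0"
  obtain a where a: "a \<in> \<A>" "infimum_map C \<A> F x = F a x"
      "\<And>b. b \<in> \<A> \<Longrightarrow> cone_le C (infimum_map C \<A> F x) (F b x)"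
    using infimum_map_attained[OF sel, where x = x] by blast
  obtain b where b: "b \<in> \<A>" "infimum_map C \<A> F (t *\<^sub>R x) = F b (t *\<^sub>R x)"
      "\<And>b. b \<in> \<A> \<Longrightarrow> cone_le C (infimum_map C \<A> F (t *\<^sub>R x)) (F b (t *\<^sub>R x))"
    using infimum_map_attained[OF sel, where x = "t *\<^sub>R x"] by blast
  have hom: "F d (t *\<^sub>R x) = t *\<^sub>R F d x" if "d \<in> \<A>" for d
    using F[OF that] t by (simp add: homogeneous_map_def)
  show "infimum_map C \<A> F (t *\<^sub>R x) = t *\<^sub>R infimum_map C \<A> F x"
  proof (rule cone_le_antisym[OF C])
    show "cone_le C (infimum_map C \<A> F (t *\<^sub>R x)) (t *\<^sub>R infimum_map C \<A> F x)"
      using b(3)[OF a(1)] hom[OF a(1)] a(2) by simp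
    show "cone_le C (t *\<^sub>R infimum_map C \<A> F x) (infimum_map C \<A> F (t *\<^sub>R x))"
      using cone_le_scaleR[OF C a(3)[OF b(1)], of t] hom[OF b(1)] b(2) t by simp
  qed
qed

text \<open>A subeigenvector of some \<open>F a\<close> is one of the smaller infimum map.
  Conversely, at a subeigenvector of the infimum map the selected \<open>F a\<close> takes the same
  value, so it has the same subeigenvector.\<close>

lemma cw_infimum_map:
  assumes C: "proper_cone C" and sel: "admits_lower_selection C \<A> F"
  shows "cw C (infimum_map C \<A> F) = (INF a\<in>\<A>. cw C (F a))"
proof (rule antisym)
  let ?f = "infimum_map C \<A> F"
  show "cw C ?f \<le> (INF a\<in>\<A>. cw C (F a))"
  proof (rule INF_greatest)
    fix a assume a: "a \<in> \<A>"
    have "cone_le C (?f x) (F a x)" for x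
      using infimum_map_attained[OF sel] a by metis
    then show "cw C ?f \<le> cw C (F a)"
      unfolding cw_def using cone_le_trans[OF C] by (intro Inf_superset_mono) blast
  qed
  show "(INF a\<in>\<A>. cw C (F a)) \<le> cw C ?f"
    unfolding cw_def[of C ?f]
  proof (rule Inf_greatest, safe)
    fix l :: real and x assume l: "l > 0" and x: "x \<in> interior C" "cone_le C (?f x) (l *\<^sub>R x)"
    obtain a where a: "a \<in> \<A>" "?f x = F a x"
      using infimum_map_attained[OF sel] by metis
    have "(INF a\<in>\<A>. cw C (F a)) \<le> cw C (F a)"
      using a(1) by (rule INF_lower)
    also have "\<dots> \<le> ereal l"
      unfolding cw_def using l x a(2) by (intro Inf_lower) auto
    finally show "(INF a\<in>\<A>. cw C (F a)) \<le> ereal l" .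
  qed
qed

text \<open>The index selected at the larger point serves as the comparison map for both
  points.\<close>

lemma order_preserving_infimum_map:
  assumes C: "proper_cone C" and sel: "admits_lower_selection C \<A> F"
    and F: "\<And>a. a \<in> \<A> \<Longrightarrow> order_preserving C (F a)"
  shows "order_preserving C (infimum_map C \<A> F)"
  unfolding order_preserving_def
proof (intro allI impI)
  fix x y assume xy: "cone_le C x y"
  obtain a where a: "a \<in> \<A>" "infimum_map C \<A> F y = F a y"
    using infimum_map_attained[OF sel] by metis
  have "cone_le C (infimum_map C \<A> F x) (F a x)"
    using infimum_map_attained[OF sel] a(1) by metis
  then show "cone_le C (infimum_map C \<A> F x) (infimum_map C \<A> F y)"
    using F[OF a(1)] xy a(2) cone_le_trans[OF C] unfolding order_preserving_def by metis
qed

theorem proposition8p2: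
  fixes C :: "'a::banach set"
    and \<A> :: "'i set"
    and F :: "'i \<Rightarrow> 'a \<Rightarrow> 'a"
    and f :: "'a \<Rightarrow> 'a"
    and \<nu> :: "'a set \<Rightarrow> real"
  assumes "homogeneous_mnc \<nu>"
    and "proper_cone C" and "interior C \<noteq> {}"
    and "\<forall>a\<in>\<A>. homogeneous_map (F a)"
    and "admits_lower_selection C \<A> F"
    and "f = infimum_map C \<A> F"
  shows "homogeneous_map f \<and>
    cw C f = (INF a\<in>\<A>. cw C (F a)) \<and>
    ((\<forall>a\<in>\<A>. continuous_on UNIV (F a) \<and> order_preserving C (F a)) \<and>
     continuous_on UNIV f \<and> normal_cone C \<longrightarrow>
       order_preserving C f \<and>
       cone_spectral_radius C f \<le> (INF a\<in>\<A>. cone_spectral_radius C (F a)) \<and>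
       (mnc_coeff \<nu> C f < cw C f \<or>
        (\<forall>B. bounded B \<and> B \<subseteq> C \<longrightarrow> uniformly_continuous_on B f) \<longrightarrow>
          cone_spectral_radius C f = (INF a\<in>\<A>. cone_spectral_radius C (F a)) \<and>
          (INF a\<in>\<A>. cone_spectral_radius C (F a)) = (INF a\<in>\<A>. cw C (F a)) \<and>
          (INF a\<in>\<A>. cw C (F a)) = cw C f))"
proof -
  note nu = assms(1) and C = assms(2,3) and hF = assms(4) and sel = assms(5) and f = assms(6)
  have hom: "homogeneous_map f"
    unfolding f using hF by (intro homogeneous_infimum_map C(1) sel) auto
  have cwf: "cw C f = (INF a\<in>\<A>. cw C (F a))"
    unfolding f by (intro cw_infimum_map C(1) sel)
  have le: "cone_le C (f x) (F a x)" if "a \<in> \<A>" for a x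
    unfolding f using infimum_map_attained[OF sel] that by metis
  show ?thesis
  proof (intro conjI hom cwf impI; elim conjE)
    assume F: "\<forall>a\<in>\<A>. continuous_on UNIV (F a) \<and> order_preserving C (F a)"
      and cont: "continuous_on UNIV f" and nC: "normal_cone C"
    show op: "order_preserving C f"
      unfolding f using F by (intro order_preserving_infimum_map C(1) sel) auto
    show rle: "cone_spectral_radius C f \<le> (INF a\<in>\<A>. cone_spectral_radius C (F a))"
      using F le by (intro INF_greatest cone_spectral_radius_mono nC hom op) auto
    assume cond: "mnc_coeff \<nu> C f < cw C f \<or>
      (\<forall>B. bounded B \<and> B \<subseteq> C \<longrightarrow> uniformly_continuous_on B f)"
    have INF_le: "(INF a\<in>\<A>. cone_spectral_radius C (F a)) \<le> (INF a\<in>\<A>. cw C (F a))"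
    proof (rule INF_mono)
      fix a assume "a \<in> \<A>"
      then show "\<exists>b\<in>\<A>. cone_spectral_radius C (F b) \<le> cw C (F a)"
        using F hF cone_spectral_radius_le_cw[OF nC] by blast
    qed
    \<comment> \<open>This closes the cycle from the spectral radius of \<open>f\<close> through
      both infima to \<open>cw C f\<close> and back, so all four numbers agree.\<close>
    have "cw C f \<le> cone_spectral_radius C f"
      by (rule cw_le_cone_spectral_radius[OF nu nC C(2) hom op cont cond])
    with rle INF_le cwf
    show "cone_spectral_radius C f = (INF a\<in>\<A>. cone_spectral_radius C (F a))"
      "(INF a\<in>\<A>. cone_spectral_radius C (F a)) = (INF a\<in>\<A>. cw C (F a))"
      "(INF a\<in>\<A>. cw C (F a)) = cw C f"
      by auto
  qed
qed

end
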